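(* Let $k,m\ge 2$ be integers. The monoid $\mathcal{POI}_{k\times m}$ has exactly $\sum_{t=0}^k\binom{k}{t}^2(m!)^t$ elements.
   Context: Let $n=km$, $\Omega_n=\{1,\dots,n\}$ and $I_i=\{(i-1)m+1,\dots,im\}$ for $1\le i\le k$. For $x\in\Omega_n$ let $i_x$ denote the index with $x\in I_{i_x}$. $\mathcal{POI}_{k\times m}$ is the monoid, under composition (maps written on the right, composed left to right), of all injective partial maps $\alpha$ from $\Omega_n$ to $\Omega_n$ (the empty map included) such that: (stability) for all $x\in\mathrm{Dom}(\alpha)$, $I_{i_x}\subseteq\mathrm{Dom}(\alpha)$ and $I_{i_x}\alpha=I_{i_{x\alpha}}$; (order preservation) for all $x,y\in\mathrm{Dom}(\alpha)$, $i_x\le i_y$ implies $i_{x\alpha}\le i_{y\alpha}$. *)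

theory Defs
  imports "HOL-Algebra.Group"
begin

text \<open>Partial maps of \<open>\<Omega>\<^sub>n = {1, \<dots>, n}\<close> are represented by total option-valued functions
  that are \<^term>\<open>None\<close> outside their domain, so that equality of partial maps (including
  equality of domains) is equality of functions.\<close>

definition Omega :: "nat \<Rightarrow> nat set" where
  "Omega n = {1..n}"

definition block :: "nat \<Rightarrow> nat \<Rightarrow> nat set" where
  "block m i = {(i - 1) * m + 1..i * m}"

definition block_index :: "nat \<Rightarrow> nat \<Rightarrow> nat \<Rightarrow> nat" where
  "block_index k m x = (THE i. i \<in> {1..k} \<and> x \<in> block m i)"

definition partial_injection :: "nat set \<Rightarrow> (nat \<rightharpoonup> nat) \<Rightarrow> bool" where
  "partial_injection A \<alpha> \<longleftrightarrow> dom \<alpha> \<subseteq> A \<and> ran \<alpha> \<subseteq> A \<and> inj_on \<alpha> (dom \<alpha>)"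

definition stable :: "nat \<Rightarrow> nat \<Rightarrow> (nat \<rightharpoonup> nat) \<Rightarrow> bool" where
  "stable k m \<alpha> \<longleftrightarrow> (\<forall>x \<in> dom \<alpha>.
     block m (block_index k m x) \<subseteq> dom \<alpha> \<and>
     (\<lambda>z. the (\<alpha> z)) ` block m (block_index k m x) = block m (block_index k m (the (\<alpha> x))))"

definition block_order_preserving :: "nat \<Rightarrow> nat \<Rightarrow> (nat \<rightharpoonup> nat) \<Rightarrow> bool" where
  "block_order_preserving k m \<alpha> \<longleftrightarrow> (\<forall>x \<in> dom \<alpha>. \<forall>y \<in> dom \<alpha>.
     block_index k m x \<le> block_index k m y \<longrightarrow>
     block_index k m (the (\<alpha> x)) \<le> block_index k m (the (\<alpha> y)))"

text \<open>Maps act on the right: the product of \<open>\<alpha>\<close> and \<open>\<beta>\<close> applies \<open>\<alpha>\<close> first.\<close>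

definition POI :: "nat \<Rightarrow> nat \<Rightarrow> (nat \<rightharpoonup> nat) monoid" where
  "POI k m =
    \<lparr>carrier = {\<alpha>. partial_injection (Omega (k * m)) \<alpha> \<and> stable k m \<alpha> \<and>
                  block_order_preserving k m \<alpha>},
     monoid.mult = (\<lambda>\<alpha> \<beta>. \<beta> \<circ>\<^sub>m \<alpha>),
     one = Some |` Omega (k * m)\<rparr>"

lemma block_index_mem:
  assumes "x \<in> Omega (k * m)"
  shows "block_index k m x \<in> {1..k} \<and> x \<in> block m (block_index k m x)"
proof -
  have x: "1 \<le> x" "x \<le> k * m" using assms by (auto simp: Omega_def)
  then have m: "m > 0" by (cases m) auto
  define i where "i = (x - 1) div m + 1"
  have lo: "((x - 1) div m) * m \<le> x - 1" by simp
  have hi: "x - 1 < ((x - 1) div m + 1) * m"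
    using m by (metis Suc_eq_plus1 dividend_less_div_times mult_Suc)
  have "(x - 1) div m < k"
    using x m by (simp add: less_mult_imp_div_less)
  then have mem: "i \<in> {1..k} \<and> x \<in> block m i"
  proof -
    have "(i - 1) * m + 1 \<le> x" "x \<le> i * m"
    proof -
      have "i - 1 = (x - 1) div m" by (simp add: i_def)
      then show "(i - 1) * m + 1 \<le> x" using lo x(1) by (metis le_diff_conv2)
      show "x \<le> i * m" using hi x(1) unfolding i_def by (metis Suc_leI Suc_diff_1 less_le_trans zero_less_one)
    qed
    then show ?thesis
      using \<open>(x - 1) div m < k\<close> unfolding block_def i_def by simp
  qed
  have uniq: "j = i" if "j \<in> {1..k} \<and> x \<in> block m j" for j
  proof -
    have "(j - 1) * m \<le> x - 1" "x - 1 < Suc (j - 1) * m"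
      using that x by (auto simp: block_def)
    then have "(x - 1) div m = j - 1"
      by (intro div_nat_eqI) (auto simp: mult.commute)
    then show ?thesis using that by (auto simp: i_def)
  qed
  show ?thesis
    unfolding block_index_def by (rule theI[of _ i]) (use mem uniq in blast)+
qed

lemma block_subset_Omega:
  assumes "i \<in> {1..k}"
  shows "block m i \<subseteq> Omega (k * m)"
proof -
  have "i * m \<le> k * m" using assms by simp
  then show ?thesis by (auto simp: block_def Omega_def)
qed

lemma monoid_POI: "Group.monoid (POI k m)"
proof (rule monoidI)
  fix \<alpha> \<beta> assume a: "\<alpha> \<in> carrier (POI k m)" and b: "\<beta> \<in> carrier (POI k m)"
  let ?b = "block_index k m" and ?g = "\<beta> \<circ>\<^sub>m \<alpha>"
  have a1: "dom \<alpha> \<subseteq> Omega (k*m)" "ran \<alpha> \<subseteq> Omega (k*m)" "inj_on \<alpha> (dom \<alpha>)"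
    and a2: "stable k m \<alpha>" and a3: "block_order_preserving k m \<alpha>"
    using a by (auto simp: POI_def partial_injection_def)
  have b1: "dom \<beta> \<subseteq> Omega (k*m)" "ran \<beta> \<subseteq> Omega (k*m)" "inj_on \<beta> (dom \<beta>)"
    and b2: "stable k m \<beta>" and b3: "block_order_preserving k m \<beta>"
    using b by (auto simp: POI_def partial_injection_def)
  have domD: "x \<in> dom \<alpha> \<and> the (\<alpha> x) \<in> dom \<beta> \<and> the (?g x) = the (\<beta> (the (\<alpha> x)))"
    if "x \<in> dom ?g" for x
    using that by (auto simp: map_comp_def split: option.splits)
  have domI: "x \<in> dom ?g" if "x \<in> dom \<alpha>" "the (\<alpha> x) \<in> dom \<beta>" for x
    using that by (auto simp: map_comp_def)
  have "dom ?g \<subseteq> Omega (k*m)" using domD a1 by blast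
  moreover have "ran ?g \<subseteq> Omega (k*m)"
  proof
    fix z assume "z \<in> ran ?g"
    then have "z \<in> ran \<beta>"
      by (auto simp: ran_def map_comp_def split: option.splits)
    then show "z \<in> Omega (k*m)" using b1(2) by blast
  qed
  moreover have "inj_on ?g (dom ?g)"
  proof (rule inj_onI)
    fix x y assume xy: "x \<in> dom ?g" "y \<in> dom ?g" "?g x = ?g y"
    obtain u v where u: "\<alpha> x = Some u" and v: "\<alpha> y = Some v"
      using domD[OF xy(1)] domD[OF xy(2)] by blast
    have uv: "u \<in> dom \<beta>" "v \<in> dom \<beta>"
      using domD[OF xy(1)] domD[OF xy(2)] u v by simp_all
    have "\<beta> u = \<beta> v" using xy(3) u v by (simp add: map_comp_def)
    then have "u = v" using b1(3) uv by (simp add: inj_on_eq_iff)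
    then have "\<alpha> x = \<alpha> y" using u v by simp
    then show "x = y"
      using a1(3) domD[OF xy(1)] domD[OF xy(2)] by (simp add: inj_on_eq_iff)
  qed
  moreover have "stable k m ?g"
    unfolding stable_def
  proof (intro ballI conjI)
    fix x assume x: "x \<in> dom ?g"
    have A: "block m (?b x) \<subseteq> dom \<alpha>"
      "(\<lambda>z. the (\<alpha> z)) ` block m (?b x) = block m (?b (the (\<alpha> x)))"
      using a2 domD[OF x] unfolding stable_def by auto
    have B: "block m (?b (the (\<alpha> x))) \<subseteq> dom \<beta>"
      "(\<lambda>z. the (\<beta> z)) ` block m (?b (the (\<alpha> x))) = block m (?b (the (\<beta> (the (\<alpha> x)))))"
      using b2 domD[OF x] unfolding stable_def by auto
    show sub: "block m (?b x) \<subseteq> dom ?g" using A B domI by blast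
    have "(\<lambda>z. the (?g z)) ` block m (?b x) = (\<lambda>z. the (\<beta> (the (\<alpha> z)))) ` block m (?b x)"
      by (rule image_cong) (use sub domD in blast)+
    also have "\<dots> = (\<lambda>z. the (\<beta> z)) ` ((\<lambda>z. the (\<alpha> z)) ` block m (?b x))"
      by (simp add: image_image)
    finally show "(\<lambda>z. the (?g z)) ` block m (?b x) = block m (?b (the (?g x)))"
      using A(2) B(2) domD[OF x] by simp
  qed
  moreover have "block_order_preserving k m ?g"
    unfolding block_order_preserving_def
  proof (intro ballI impI)
    fix x y assume "x \<in> dom ?g" "y \<in> dom ?g" "?b x \<le> ?b y"
    then show "?b (the (?g x)) \<le> ?b (the (?g y))"
      using domD[of x] domD[of y] a3 b3 unfolding block_order_preserving_def by metis
  qed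
  ultimately show "\<alpha> \<otimes>\<^bsub>POI k m\<^esub> \<beta> \<in> carrier (POI k m)"
    by (simp add: POI_def partial_injection_def)
next
  let ?e = "Some |` Omega (k * m)"
  have d: "dom ?e = Omega (k*m)" by (auto simp: restrict_map_def split: if_splits)
  have e: "?e x = Some x" if "x \<in> Omega (k*m)" for x using that by simp
  have "stable k m ?e"
    unfolding stable_def d
  proof (intro ballI conjI)
    fix x assume x: "x \<in> Omega (k*m)"
    show s: "block m (block_index k m x) \<subseteq> Omega (k*m)"
      using block_index_mem[OF x] block_subset_Omega by blast
    have "(\<lambda>z. the (?e z)) ` block m (block_index k m x) = (\<lambda>z. z) ` block m (block_index k m x)"
      by (rule image_cong) (use s e in auto)
    then show "(\<lambda>z. the (?e z)) ` block m (block_index k m x) = block m (block_index k m (the (?e x)))"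
      using e[OF x] by simp
  qed
  moreover have "partial_injection (Omega (k*m)) ?e"
    unfolding partial_injection_def d
    by (auto simp: ran_def restrict_map_def inj_on_def split: if_splits)
  moreover have "block_order_preserving k m ?e"
    unfolding block_order_preserving_def d by simp
  ultimately show "\<one>\<^bsub>POI k m\<^esub> \<in> carrier (POI k m)" by (simp add: POI_def)
next
  fix \<alpha> \<beta> \<gamma>
  show "\<alpha> \<otimes>\<^bsub>POI k m\<^esub> \<beta> \<otimes>\<^bsub>POI k m\<^esub> \<gamma> = \<alpha> \<otimes>\<^bsub>POI k m\<^esub> (\<beta> \<otimes>\<^bsub>POI k m\<^esub> \<gamma>)"
    by (auto simp: POI_def map_comp_def fun_eq_iff split: option.splits)
next
  fix \<alpha> assume "\<alpha> \<in> carrier (POI k m)"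
  then have a: "dom \<alpha> \<subseteq> Omega (k*m)" "ran \<alpha> \<subseteq> Omega (k*m)"
    by (auto simp: POI_def partial_injection_def)
  have n: "\<alpha> x = None" if "x \<notin> Omega (k*m)" for x
    using a(1) that by (meson domIff subsetD)
  have r: "y \<in> Omega (k*m)" if "\<alpha> x = Some y" for x y
    using a(2) that by (meson ranI subsetD)
  show "\<one>\<^bsub>POI k m\<^esub> \<otimes>\<^bsub>POI k m\<^esub> \<alpha> = \<alpha>"
    by (auto simp: POI_def map_comp_def restrict_map_def fun_eq_iff n)
  show "\<alpha> \<otimes>\<^bsub>POI k m\<^esub> \<one>\<^bsub>POI k m\<^esub> = \<alpha>"
    by (auto simp: POI_def map_comp_def restrict_map_def fun_eq_iff r split: option.splits)
qed

end

theory Submission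
  imports Defs "HOL-Library.Disjoint_Sets" "HOL-Library.Infinite_Set"
begin

text \<open>An element \<open>\<alpha>\<close> of the monoid is the same thing as a set \<open>A\<close> of block indices (the blocks
  forming its domain), a map \<open>\<psi>\<close> on \<open>A\<close> which is strictly increasing (\<open>\<alpha>\<close> preserves the order of
  blocks, and is injective), and for every \<open>i \<in> A\<close> a bijection from block \<open>i\<close> onto block \<open>\<psi> i\<close>.
  Since \<open>\<psi>\<close> is determined by its image, an arbitrary set of block indices of the same size as \<open>A\<close>,
  a domain of \<open>t\<close> blocks contributes \<open>(k choose t) * (m!)\<^sup>t\<close> elements.\<close>

section \<open>Strictly increasing maps and their images\<close>

text \<open>Induct on the point. If \<open>p i < q i\<close>, the value \<open>p i\<close> is
  attained by \<open>q\<close> at some \<open>j < i\<close>; there the maps agree, so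
  \<open>p j = p i\<close>, against strict growth of \<open>p\<close>. The situation is symmetric in
  the two maps.\<close>

lemma strict_mono_on_image_eqD:
  fixes f g :: "'a::wellorder \<Rightarrow> 'b::linorder"
  assumes "strict_mono_on A f" "strict_mono_on A g" "f ` A = g ` A" "i \<in> A"
  shows "f i = g i"
  using assms(4)
proof (induction i rule: less_induct)
  case (less i)
  have step: "\<not> p i < q i"
    if p: "strict_mono_on A p" and q: "strict_mono_on A q" and pq: "p ` A = q ` A"
      and IH: "\<And>j. j < i \<Longrightarrow> j \<in> A \<Longrightarrow> p j = q j" for p q :: "'a \<Rightarrow> 'b"
  proof
    assume lt: "p i < q i"
    obtain j where j: "j \<in> A" "p i = q j" using pq less.prems by blast
    then have "j < i" using q lt less.prems by (metis strict_mono_on_less)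
    then show False using IH[of j] j p less.prems by (metis less_irrefl strict_mono_onD)
  qed
  show ?case
    using step[OF assms(1,2,3)] step[OF assms(2,1) assms(3)[symmetric]] less.IH
    by (metis linorder_less_linear)
qed

text \<open>Both sets are enumerated increasingly by \<open>{..<card A}\<close>; undoing the
  enumeration of \<open>A\<close> and then applying that of \<open>B\<close> gives the map.\<close>

lemma ex_strict_mono_on_image:
  fixes A :: "'a::wellorder set" and B :: "'b::wellorder set"
  assumes "finite A" "finite B" "card A = card B"
  obtains f where "strict_mono_on A f" "f ` A = B"
proof -
  obtain h where h: "bij_betw h {..<card A} A" "strict_mono_on {..<card A} h"
    using ex_bij_betw_strict_mono_card[OF assms(1)] by blast
  obtain h' where h': "bij_betw h' {..<card A} B" "strict_mono_on {..<card A} h'"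
    using ex_bij_betw_strict_mono_card[OF assms(2)] assms(3) by metis
  define f where "f = h' \<circ> inv_into {..<card A} h"
  have inv: "bij_betw (inv_into {..<card A} h) A {..<card A}"
    using h(1) by (rule bij_betw_inv_into)
  show ?thesis
  proof
    show "f ` A = B"
      using bij_betw_trans[OF inv h'(1)] by (simp add: f_def bij_betw_def)
    show "strict_mono_on A f"
    proof (rule strict_mono_onI)
      fix x y assume xy: "x \<in> A" "y \<in> A" "x < y"
      let ?g = "inv_into {..<card A} h"
      have m: "?g x \<in> {..<card A}" "?g y \<in> {..<card A}" using inv xy bij_betwE by blast+
      have "h (?g x) = x" "h (?g y) = y"
        using h(1) xy by (auto simp: bij_betw_def f_inv_into_f)
      then have "?g x < ?g y" using xy(3) m h(2) by (metis strict_mono_on_less)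
      then show "f x < f y" using m h'(2) by (auto simp: f_def strict_mono_on_def)
    qed
  qed
qed

text \<open>The maps are extensional, so that each map on \<open>A\<close> is represented by exactly
  one function and can be counted.\<close>

definition strict_mono_maps :: "'a::order set \<Rightarrow> 'b::order set \<Rightarrow> ('a \<Rightarrow> 'b) set" where
  "strict_mono_maps A C = {f \<in> A \<rightarrow>\<^sub>E C. strict_mono_on A f}"

text \<open>Sending a map to its image is a bijection onto the subsets of \<open>C\<close> of size
  \<open>card A\<close>, by the two preceding lemmas.\<close>

lemma card_strict_mono_maps:
  fixes A :: "'a::wellorder set" and C :: "'b::wellorder set"
  assumes "finite A" "finite C"
  shows "card (strict_mono_maps A C) = card C choose card A"
proof -
  have "bij_betw (\<lambda>f. f ` A) (strict_mono_maps A C) {B. B \<subseteq> C \<and> card B = card A}"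
  proof (rule bij_betw_imageI)
    show "inj_on (\<lambda>f. f ` A) (strict_mono_maps A C)"
    proof (rule inj_onI)
      fix f g assume "f \<in> strict_mono_maps A C" "g \<in> strict_mono_maps A C" "f ` A = g ` A"
      then show "f = g"
        using strict_mono_on_image_eqD[of A f g]
        by (intro PiE_ext[of f A "\<lambda>_. C" g]) (auto simp: strict_mono_maps_def)
    qed
    show "(\<lambda>f. f ` A) ` strict_mono_maps A C = {B. B \<subseteq> C \<and> card B = card A}" (is "?l = ?r")
    proof
      show "?l \<subseteq> ?r"
        by (auto simp: strict_mono_maps_def strict_mono_on_imp_inj_on card_image)
      show "?r \<subseteq> ?l"
      proof
        fix B assume "B \<in> ?r"
        then have B: "B \<subseteq> C" "card A = card B" by auto
        have "finite B" using B(1) assms(2) by (rule finite_subset)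
        then obtain f where f: "strict_mono_on A f" "f ` A = B"
          using ex_strict_mono_on_image[OF assms(1) _ B(2)] by blast
        have "restrict f A \<in> strict_mono_maps A C"
          using f B by (auto simp: strict_mono_maps_def strict_mono_on_def)
        moreover have "restrict f A ` A = B" using f by auto
        ultimately show "B \<in> ?l" by blast
      qed
    qed
  qed
  then show ?thesis using n_subsets[OF assms(2)] by (simp add: bij_betw_same_card)
qed

section \<open>Counting partial maps that are bijective on each piece\<close>

text \<open>Bijectivity is asked on each piece separately; for blocks, injectivity across pieces
  will come from strict monotonicity of \<psi>.\<close>

definition piecewise_bijections ::
    "'i set \<Rightarrow> ('i \<Rightarrow> 'a set) \<Rightarrow> ('i \<Rightarrow> 'b set) \<Rightarrow> ('a \<rightharpoonup> 'b) set" where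
  "piecewise_bijections A X Y =
     {\<alpha>. dom \<alpha> = (\<Union>i\<in>A. X i) \<and> (\<forall>i\<in>A. bij_betw (\<lambda>x. the (\<alpha> x)) (X i) (Y i))}"

text \<open>The pieces of the domain are disjoint, so the bijections on them are chosen
  independently: cutting and gluing identify the maps with a dependent product of
  \<open>card A\<close> factors of size \<open>fact n\<close>.\<close>

lemma card_piecewise_bijections:
  assumes A: "finite A" and disj: "disjoint_family_on X A"
    and X: "\<And>i. i \<in> A \<Longrightarrow> finite (X i) \<and> card (X i) = n"
    and Y: "\<And>i. i \<in> A \<Longrightarrow> finite (Y i) \<and> card (Y i) = n"
  shows "card (piecewise_bijections A X Y) = fact n ^ card A"
    and "finite (piecewise_bijections A X Y)"
proof -
  \<comment> \<open>Injections are easier to count than bijections; since \<open>X i\<close> and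
    \<open>Y i\<close> have the same finite size, they are the same thing.\<close>
  define F where "F i = {f \<in> X i \<rightarrow>\<^sub>E Y i. inj_on f (X i)}" for i
  define idx where "idx x = (THE i. i \<in> A \<and> x \<in> X i)" for x
  have idx: "idx x = i" if "i \<in> A" "x \<in> X i" for i x
    unfolding idx_def using that disj by (intro the_equality) (auto simp: disjoint_family_on_def)
  define pieces where "pieces \<alpha> = (\<lambda>i\<in>A. \<lambda>x\<in>X i. the (\<alpha> x :: 'c option))" for \<alpha>
  define glue where "glue f x = (if x \<in> (\<Union>i\<in>A. X i) then Some (f (idx x) x :: 'c) else None)"
    for f x
  have bij: "bij_betw f (X i) (Y i)" if "f \<in> F i" "i \<in> A" for f i
  proof -
    have "f ` X i \<subseteq> Y i" "inj_on f (X i)" using that by (auto simp: F_def)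
    moreover from this have "f ` X i = Y i"
      using X[OF that(2)] Y[OF that(2)] by (intro card_subset_eq) (auto simp: card_image)
    ultimately show ?thesis by (simp add: bij_betw_def)
  qed
  have "bij_betw pieces (piecewise_bijections A X Y) (Pi\<^sub>E A F)"
  proof (rule bij_betw_byWitness[where f' = "glue"])
    show "\<forall>\<alpha>\<in>piecewise_bijections A X Y. glue (pieces \<alpha>) = \<alpha>"
    proof (intro ballI ext)
      fix \<alpha> x assume a: "\<alpha> \<in> piecewise_bijections A X Y"
      then have d: "dom \<alpha> = (\<Union>i\<in>A. X i)" by (simp add: piecewise_bijections_def)
      show "glue (pieces \<alpha>) x = \<alpha> x"
      proof (cases "x \<in> dom \<alpha>")
        case True
        then obtain i where i: "i \<in> A" "x \<in> X i" using d by auto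
        then have "glue (pieces \<alpha>) x = Some (the (\<alpha> x))"
          using idx[OF i] by (auto simp: glue_def pieces_def)
        then show ?thesis using True by auto
      next
        case False
        then show ?thesis unfolding glue_def d[symmetric] by (auto simp: domIff)
      qed
    qed
    show "\<forall>f\<in>Pi\<^sub>E A F. pieces (glue f) = f"
    proof
      fix f assume f: "f \<in> Pi\<^sub>E A F"
      show "pieces (glue f) = f"
      proof
        fix i show "pieces (glue f) i = f i"
        proof (cases "i \<in> A")
          case True
          then have "f i \<in> F i" using f by (auto simp: PiE_mem)
          then have "f i \<in> X i \<rightarrow>\<^sub>E Y i" by (simp add: F_def)
          then have "(\<lambda>x\<in>X i. f i x) = f i" by (simp add: extensional_restrict PiE_def)
          moreover have "(\<lambda>x\<in>X i. the (glue f x)) = (\<lambda>x\<in>X i. f i x)"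
            using True idx by (auto simp: glue_def restrict_def)
          ultimately show ?thesis using True by (simp add: pieces_def)
        next
          case False
          then show ?thesis using PiE_arb[OF f] by (simp add: pieces_def)
        qed
      qed
    qed
    show "pieces ` piecewise_bijections A X Y \<subseteq> Pi\<^sub>E A F"
    proof
      fix f assume "f \<in> pieces ` piecewise_bijections A X Y"
      then obtain \<alpha> where \<alpha>: "\<alpha> \<in> piecewise_bijections A X Y" "f = pieces \<alpha>" by auto
      have "(\<lambda>x\<in>X i. the (\<alpha> x)) \<in> F i" if "i \<in> A" for i
      proof -
        have "bij_betw (\<lambda>x. the (\<alpha> x)) (X i) (Y i)"
          using \<alpha>(1) that by (simp add: piecewise_bijections_def)
        then show ?thesis by (auto simp: F_def bij_betw_def)
      qed
      then show "f \<in> Pi\<^sub>E A F" by (simp add: \<alpha>(2) pieces_def)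
    qed
    show "glue ` Pi\<^sub>E A F \<subseteq> piecewise_bijections A X Y"
    proof
      fix \<alpha> assume "\<alpha> \<in> glue ` Pi\<^sub>E A F"
      then obtain f where f: "f \<in> Pi\<^sub>E A F" "\<alpha> = glue f" by auto
      have "bij_betw (\<lambda>x. the (\<alpha> x)) (X i) (Y i)" if i: "i \<in> A" for i
      proof -
        have "bij_betw (f i) (X i) (Y i)" using f(1) i bij by (auto simp: PiE_mem)
        moreover have "the (\<alpha> x) = f i x" if "x \<in> X i" for x
          using that i idx[OF i that] by (auto simp: f(2) glue_def)
        ultimately show ?thesis using bij_betw_cong[of "X i" "f i" "\<lambda>x. the (\<alpha> x)"] by simp
      qed
      then show "\<alpha> \<in> piecewise_bijections A X Y"
        by (auto simp: piecewise_bijections_def f(2) glue_def dom_def)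
    qed
  qed
  \<comment> \<open>The number of injections is a falling factorial with \<open>n\<close> factors
    starting at \<open>n\<close>.\<close>
  moreover have "card (F i) = fact n" if "i \<in> A" for i
    unfolding F_def using card_inj_on_subset_funcset[of "X i" "Y i" "X i"] X[OF that] Y[OF that]
    by (simp add: fact_prod_rev atLeast0LessThan)
  then have "card (Pi\<^sub>E A F) = fact n ^ card A"
    by (simp add: card_PiE[OF A])
  ultimately show c: "card (piecewise_bijections A X Y) = fact n ^ card A"
    by (metis bij_betw_same_card)
  \<comment> \<open>An infinite set has \<open>card\<close> 0, whereas this one has positive
    \<open>card\<close>.\<close>
  show "finite (piecewise_bijections A X Y)"
    using c by (intro card_ge_0_finite) simp
qed

section \<open>Elementary facts about blocks\<close>

lemma block_disjoint:
  assumes "i \<noteq> j"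
  shows "block m i \<inter> block m j = {}"
proof -
  have "block m a \<inter> block m b = {}" if "a < b" for a b
  proof -
    have "a * m \<le> (b - 1) * m" using that by (intro mult_right_mono) auto
    then have "\<not> y \<le> a * m" if "(b - 1) * m + 1 \<le> y" for y using that by linarith
    then show ?thesis unfolding block_def by (meson atLeastAtMost_iff disjoint_iff)
  qed
  then show ?thesis using assms by (metis Int_commute linorder_neqE_nat)
qed

lemma mem_block_unique: "x \<in> block m i \<Longrightarrow> x \<in> block m j \<Longrightarrow> i = j"
  using block_disjoint by blast

text \<open>Index 0 is excluded because truncated subtraction makes \<open>block m 0\<close> the
  empty interval \<open>{1..0}\<close>.\<close>

lemma card_block: "i \<ge> 1 \<Longrightarrow> card (block m i) = m"
  by (cases i) (auto simp: block_def)

text \<open>The right endpoint \<open>i * m\<close> serves below as the representative of block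
  \<open>i\<close>.\<close>

lemma last_mem_block: "i \<ge> 1 \<Longrightarrow> m > 0 \<Longrightarrow> i * m \<in> block m i"
  by (cases i) (auto simp: block_def)

lemma block_index_eq:
  assumes "i \<in> {1..k}" "x \<in> block m i"
  shows "block_index k m x = i"
proof -
  have "x \<in> block m (block_index k m x)"
    using assms block_subset_Omega block_index_mem by blast
  then show ?thesis using assms(2) by (simp add: mem_block_unique)
qed

section \<open>Decomposition of the monoid by block data\<close>

lemma carrier_POI_subset:
  assumes "m > 0" and \<alpha>: "\<alpha> \<in> carrier (POI k m)"
  obtains A \<psi> where "A \<subseteq> {1..k}" "\<psi> \<in> strict_mono_maps A {1..k}"
    "\<alpha> \<in> piecewise_bijections A (block m) (\<lambda>i. block m (\<psi> i))"
proof -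
  let ?b = "block_index k m" and ?a = "\<lambda>x. the (\<alpha> x)"
  have a: "dom \<alpha> \<subseteq> Omega (k*m)" "ran \<alpha> \<subseteq> Omega (k*m)" "inj_on \<alpha> (dom \<alpha>)"
    and st: "stable k m \<alpha>" and op: "block_order_preserving k m \<alpha>"
    using \<alpha> by (auto simp: POI_def partial_injection_def)
  have inj: "inj_on ?a (dom \<alpha>)"
    using a(3) unfolding inj_on_def by (metis domIff option.expand)
  have ranD: "?a x \<in> Omega (k*m)" if "x \<in> dom \<alpha>" for x
    using that a(2) by (auto simp: ran_def)
  define A where "A = ?b ` dom \<alpha>"
  \<comment> \<open>The target block is read off at the right endpoint; by stability the whole block
    \<open>i\<close> is mapped onto it. Restricting to \<open>A\<close> makes \<psi>
    extensional.\<close>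
  define \<psi> where "\<psi> = (\<lambda>i\<in>A. ?b (?a (i * m)))"
  have A: "A \<subseteq> {1..k}" using a(1) block_index_mem by (fastforce simp: A_def)
  have sub: "block m i \<subseteq> dom \<alpha>" if "i \<in> A" for i
    using that st by (auto simp: A_def stable_def)
  have last: "i * m \<in> block m i" "i * m \<in> dom \<alpha>" "?b (i * m) = i" if "i \<in> A" for i
  proof -
    show l: "i * m \<in> block m i" using that A assms(1) by (auto intro!: last_mem_block)
    then show "i * m \<in> dom \<alpha>" using sub that by auto
    show "?b (i * m) = i" using l that A by (intro block_index_eq) auto
  qed
  have dom: "dom \<alpha> = (\<Union>i\<in>A. block m i)"
    using sub a(1) block_index_mem by (fastforce simp: A_def)
  have img: "?a ` block m i = block m (\<psi> i)" if "i \<in> A" for i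
  proof -
    have "?a ` block m (?b (i * m)) = block m (?b (?a (i * m)))"
      using st last(2)[OF that] unfolding stable_def by blast
    then show ?thesis using last(3)[OF that] that by (simp add: \<psi>_def)
  qed
  have bij: "bij_betw ?a (block m i) (block m (\<psi> i))" if "i \<in> A" for i
    using img[OF that] inj_on_subset[OF inj sub[OF that]] by (simp add: bij_betw_def)
  have "\<psi> i < \<psi> j" if ij: "i \<in> A" "j \<in> A" "i < j" for i j
  proof -
    have "\<psi> i \<le> \<psi> j"
      using op last(2,3)[OF ij(1)] last(2,3)[OF ij(2)] ij
      unfolding block_order_preserving_def by (simp add: \<psi>_def)
    \<comment> \<open>Order preservation gives only \<le>. Equality would make \<alpha> map two
      disjoint nonempty blocks onto the same block, against injectivity.\<close>
    moreover have "\<psi> i \<noteq> \<psi> j"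
    proof
      assume "\<psi> i = \<psi> j"
      then have "?a ` block m i = ?a ` block m j" using img ij by simp
      then have "block m i = block m j"
        using inj sub ij by (simp add: inj_on_image_eq_iff)
      then show False using block_disjoint[of i j m] last(1)[OF ij(1)] ij(3) by auto
    qed
    ultimately show ?thesis by simp
  qed
  moreover have "\<psi> \<in> A \<rightarrow>\<^sub>E {1..k}"
  proof (rule PiE_I)
    fix i assume i: "i \<in> A"
    then show "\<psi> i \<in> {1..k}"
      using block_index_mem[OF ranD[OF last(2)[OF i]]] by (simp add: \<psi>_def)
  qed (simp add: \<psi>_def)
  ultimately have "\<psi> \<in> strict_mono_maps A {1..k}"
    by (auto simp: strict_mono_maps_def strict_mono_on_def)
  with A show thesis
    using that dom bij by (auto simp: piecewise_bijections_def)
qed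

text \<open>On the domain, \<alpha> acts on block indices as \<psi>, so stability and order
  preservation are inherited from the block bijections and from \<psi>.\<close>

lemma piecewise_bijections_subset_POI:
  assumes A: "A \<subseteq> {1..k}" and \<psi>: "\<psi> \<in> strict_mono_maps A {1..k}"
    and \<alpha>: "\<alpha> \<in> piecewise_bijections A (block m) (\<lambda>i. block m (\<psi> i))"
  shows "\<alpha> \<in> carrier (POI k m)"
proof -
  let ?b = "block_index k m" and ?a = "\<lambda>x. the (\<alpha> x)"
  have dom: "dom \<alpha> = (\<Union>i\<in>A. block m i)"
    and bij: "\<And>i. i \<in> A \<Longrightarrow> bij_betw ?a (block m i) (block m (\<psi> i))"
    using \<alpha> by (auto simp: piecewise_bijections_def)
  have \<psi>k: "\<psi> i \<in> {1..k}" if "i \<in> A" for i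
    using that \<psi> by (auto simp: strict_mono_maps_def)
  have \<psi>m: "strict_mono_on A \<psi>" using \<psi> by (auto simp: strict_mono_maps_def)
  have idx: "?b x \<in> A" "x \<in> block m (?b x)" "?a x \<in> block m (\<psi> (?b x))"
    "?b (?a x) = \<psi> (?b x)" if "x \<in> dom \<alpha>" for x
  proof -
    obtain i where i: "i \<in> A" "x \<in> block m i" using \<open>x \<in> dom \<alpha>\<close> dom by auto
    then have x: "?b x = i" using A by (intro block_index_eq) auto
    show "?b x \<in> A" "x \<in> block m (?b x)" using x i by auto
    show y: "?a x \<in> block m (\<psi> (?b x))" using x i bij bij_betwE by blast
    show "?b (?a x) = \<psi> (?b x)" using y \<psi>k x i by (intro block_index_eq) auto
  qed
  have "dom \<alpha> \<subseteq> Omega (k*m)"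
    using dom A block_subset_Omega by blast
  moreover have "ran \<alpha> \<subseteq> Omega (k*m)"
  proof
    fix y assume "y \<in> ran \<alpha>"
    then obtain x where x: "\<alpha> x = Some y" by (auto simp: ran_def)
    then have "y \<in> block m (\<psi> (?b x))" "\<psi> (?b x) \<in> {1..k}"
      using idx(3)[of x] \<psi>k[OF idx(1)[of x]] by auto
    then show "y \<in> Omega (k*m)" using block_subset_Omega by blast
  qed
  \<comment> \<open>Equal values lie in the same target block, so injectivity of \<psi> puts both
    arguments in one block, where \<alpha> is injective.\<close>
  moreover have "inj_on \<alpha> (dom \<alpha>)"
  proof (rule inj_onI)
    fix x y assume xy: "x \<in> dom \<alpha>" "y \<in> dom \<alpha>" "\<alpha> x = \<alpha> y"
    then have "\<psi> (?b x) = \<psi> (?b y)" using idx(4) by metis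
    then have "?b x = ?b y"
      using strict_mono_on_imp_inj_on[OF \<psi>m] idx(1) xy by (simp add: inj_on_eq_iff)
    then show "x = y"
      using bij_betw_imp_inj_on[OF bij[OF idx(1)[OF xy(1)]]] idx(2) xy by (metis inj_onD)
  qed
  moreover have "stable k m \<alpha>"
    unfolding stable_def using idx(1,4) dom bij by (auto simp: bij_betw_def)
  moreover have "block_order_preserving k m \<alpha>"
    unfolding block_order_preserving_def
    using idx(1,4) \<psi>m by (auto simp: strict_mono_on_leD)
  ultimately show ?thesis by (simp add: POI_def partial_injection_def)
qed

lemma carrier_POI_eq:
  assumes "m > 0"
  shows "carrier (POI k m) = (\<Union>(A, \<psi>) \<in> Sigma (Pow {1..k}) (\<lambda>A. strict_mono_maps A {1..k}).
           piecewise_bijections A (block m) (\<lambda>i. block m (\<psi> i)))"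
    (is "_ = ?U")
proof
  show "carrier (POI k m) \<subseteq> ?U"
  proof
    fix \<alpha> assume "\<alpha> \<in> carrier (POI k m)"
    then obtain A \<psi> where "A \<subseteq> {1..k}" "\<psi> \<in> strict_mono_maps A {1..k}"
      "\<alpha> \<in> piecewise_bijections A (block m) (\<lambda>i. block m (\<psi> i))"
      using carrier_POI_subset[OF assms] by blast
    then show "\<alpha> \<in> ?U" by (intro UN_I[of "(A, \<psi>)"]) auto
  qed
  show "?U \<subseteq> carrier (POI k m)"
    by (clarsimp simp: piecewise_bijections_subset_POI)
qed

text \<open>This makes the union in \<open>carrier_POI_eq\<close> disjoint. The domain of \<alpha>
  determines \<open>A\<close>, and the image of each block determines \<psi>, because distinct
  blocks are disjoint and those with positive index are nonempty.\<close>

lemma piecewise_bijections_block_unique: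
  assumes "m > 0" "A \<subseteq> {1..k}" "A' \<subseteq> {1..k}"
    and \<psi>: "\<psi> \<in> strict_mono_maps A {1..k}" "\<psi>' \<in> strict_mono_maps A' {1..k}"
    and \<alpha>: "\<alpha> \<in> piecewise_bijections A (block m) (\<lambda>i. block m (\<psi> i))"
      "\<alpha> \<in> piecewise_bijections A' (block m) (\<lambda>i. block m (\<psi>' i))"
  shows "A = A' \<and> \<psi> = \<psi>'"
proof
  have un: "(\<Union>i\<in>A. block m i) = (\<Union>i\<in>A'. block m i)"
    using \<alpha> by (auto simp: piecewise_bijections_def)
  have sub: "B \<subseteq> B'" if B: "B \<subseteq> {1..k}" "(\<Union>i\<in>B. block m i) \<subseteq> (\<Union>i\<in>B'. block m i)" for B B'
  proof
    fix i assume i: "i \<in> B"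
    then have l: "i * m \<in> block m i" using B(1) assms(1) by (auto intro!: last_mem_block)
    then have "i * m \<in> (\<Union>i\<in>B'. block m i)" using B(2) i by (meson UN_I subsetD)
    then obtain j where "j \<in> B'" "i * m \<in> block m j" by blast
    then show "i \<in> B'" using l by (metis mem_block_unique)
  qed
  show AA: "A = A'" using sub[OF assms(2)] sub[OF assms(3)] un by (intro equalityI) simp_all
  show "\<psi> = \<psi>'"
  proof (rule PiE_ext)
    show "\<psi> \<in> A \<rightarrow>\<^sub>E {1..k}" "\<psi>' \<in> A \<rightarrow>\<^sub>E {1..k}"
      using \<psi> AA by (auto simp: strict_mono_maps_def)
    fix i assume i: "i \<in> A"
    have "block m (\<psi> i) = block m (\<psi>' i)"
      using \<alpha> i AA by (auto simp: piecewise_bijections_def bij_betw_def)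
    moreover have "\<psi> i * m \<in> block m (\<psi> i)"
      using \<psi>(1) i assms(1) by (intro last_mem_block) (auto simp: strict_mono_maps_def PiE_iff)
    ultimately show "\<psi> i = \<psi>' i" by (metis mem_block_unique)
  qed
qed

section \<open>Summation over the block data\<close>

lemma sum_Pow_card:
  assumes "finite S"
  shows "(\<Sum>A\<in>Pow S. f (card A)) = (\<Sum>t = 0..card S. (card S choose t) * f t)"
proof -
  have "(\<Sum>A\<in>Pow S. f (card A)) = (\<Sum>t = 0..card S. \<Sum>A | A \<in> Pow S \<and> card A = t. f (card A))"
    using assms by (intro sum.group[symmetric]) (auto simp: card_mono)
  also have "\<dots> = (\<Sum>t = 0..card S. (card S choose t) * f t)"
    using n_subsets[OF assms] by (intro sum.cong) auto
  finally show ?thesis .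
qed

theorem proposition2p1:
  fixes k m :: nat
  assumes "k \<ge> 2" and "m \<ge> 2"
  shows "card (carrier (POI k m)) = (\<Sum>t = 0..k. (k choose t)\<^sup>2 * (fact m) ^ t)"
proof -
  let ?S = "\<lambda>A. strict_mono_maps A {1..k}"
  let ?P = "\<lambda>A \<psi>. piecewise_bijections A (block m) (\<lambda>i. block m (\<psi> i))"
  have m: "m > 0" using assms by simp
  have fS: "finite (?S A)" if "A \<in> Pow {1..k}" for A
    using that finite_PiE[of A "\<lambda>_. {1..k}"] finite_subset[of A "{1..k}"]
    by (auto simp: strict_mono_maps_def)
  have P: "card (?P A \<psi>) = fact m ^ card A \<and> finite (?P A \<psi>)"
    if "A \<in> Pow {1..k}" "\<psi> \<in> ?S A" for A \<psi>
  proof -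
    have "finite (block m i)" for i by (simp add: block_def)
    moreover have "finite A" using that finite_subset by auto
    moreover have "disjoint_family_on (block m) A"
      using block_disjoint by (auto simp: disjoint_family_on_def)
    moreover have "card (block m i) = m" "card (block m (\<psi> i)) = m" if i: "i \<in> A" for i
      using i \<open>A \<in> Pow {1..k}\<close> \<open>\<psi> \<in> ?S A\<close>
      by (auto intro!: card_block simp: strict_mono_maps_def PiE_iff)
    ultimately show ?thesis
      using card_piecewise_bijections[of A "block m" m "\<lambda>i. block m (\<psi> i)"] by auto
  qed
  have "card (carrier (POI k m)) = (\<Sum>(A, \<psi>) \<in> Sigma (Pow {1..k}) ?S. card (?P A \<psi>))"
    unfolding carrier_POI_eq[OF m] case_prod_unfold
  proof (rule card_UN_disjoint)
    show "finite (Sigma (Pow {1..k}) ?S)" using fS by auto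
    show "\<forall>p\<in>Sigma (Pow {1..k}) ?S. finite (?P (fst p) (snd p))" using P by auto
    have "p = q" if "p \<in> Sigma (Pow {1..k}) ?S" "q \<in> Sigma (Pow {1..k}) ?S"
      "\<alpha> \<in> ?P (fst p) (snd p)" "\<alpha> \<in> ?P (fst q) (snd q)" for p q \<alpha>
      using piecewise_bijections_block_unique[OF m _ _ _ _ that(3,4), of k] that(1,2)
      by (cases p, cases q) simp
    then show "\<forall>p\<in>Sigma (Pow {1..k}) ?S. \<forall>q\<in>Sigma (Pow {1..k}) ?S. p \<noteq> q \<longrightarrow>
            ?P (fst p) (snd p) \<inter> ?P (fst q) (snd q) = {}"
      by blast
  qed
  also have "\<dots> = (\<Sum>A\<in>Pow {1..k}. \<Sum>\<psi>\<in>?S A. card (?P A \<psi>))"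
    using fS by (intro sum.Sigma[symmetric]) auto
  \<comment> \<open>The inner summand does not depend on \<psi>, so it is multiplied by the number
    of strictly increasing maps from \<open>A\<close> to \<open>{1..k}\<close>.\<close>
  also have "\<dots> = (\<Sum>A\<in>Pow {1..k}. (k choose card A) * fact m ^ card A)"
    using P card_strict_mono_maps[of _ "{1..k}"] finite_subset[of _ "{1..k}"]
    by (intro sum.cong) auto
  \<comment> \<open>Grouping the sets \<open>A\<close> by size \<open>t\<close> supplies the second
    binomial factor, hence the square: one factor counts domains, the other images.\<close>
  also have "\<dots> = (\<Sum>t = 0..k. (k choose t) * ((k choose t) * fact m ^ t))"
    using sum_Pow_card[of "{1..k}" "\<lambda>t. (k choose t) * fact m ^ t"] by simp
  finally show ?thesis by (simp add: power2_eq_square mult.assoc)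
qed

end
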